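(* Let $G$ be a finite abstract simplicial complex and for $x,y\in G$ let $g(x,y)=\omega(x)\,\omega(y)\,\chi(U(x)\cap U(y))$. Then $\sum_{x,y\in G} g(x,y)=\chi(G)$.
   Context: A finite abstract simplicial complex $G$ is a finite set of non-empty finite sets closed under taking non-empty subsets. For $x\in G$, $\dim(x)=|x|-1$, $\omega(x)=(-1)^{\dim(x)}$, and $U(x)=\{y\in G: x\subset y\}$ (inclusion not necessarily strict). For any subset $A\subset G$, $\chi(A)=\sum_{x\in A}\omega(x)$. *)

theory Defs
  imports Main
begin

definition finite_abstract_simplicial_complex :: "'a set set \<Rightarrow> bool" where
  "finite_abstract_simplicial_complex G \<longleftrightarrow>
     finite G \<and> (\<forall>x\<in>G. finite x \<and> x \<noteq> {}) \<and>
     (\<forall>x\<in>G. \<forall>y. y \<subseteq> x \<and> y \<noteq> {} \<longrightarrow> y \<in> G)"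

(* Natural-number subtraction: no truncation occurs, since simplices are finite and non-empty. *)
definition simplex_dim :: "'a set \<Rightarrow> nat" where
  "simplex_dim x = card x - 1"

definition omega :: "'a set \<Rightarrow> int" where
  "omega x = (-1) ^ simplex_dim x"

definition euler_char :: "'a set set \<Rightarrow> int" where
  "euler_char A = (\<Sum>x\<in>A. omega x)"

definition star :: "'a set set \<Rightarrow> 'a set \<Rightarrow> 'a set set" where
  "star G x = {y \<in> G. x \<subseteq> y}"

definition green :: "'a set set \<Rightarrow> 'a set \<Rightarrow> 'a set \<Rightarrow> int" where
  "green G x y = omega x * omega y * euler_char (star G x \<inter> star G y)"

end

theory Submission
  imports Defs
begin

text \<open>
  Exchanging the order of summation turns the total Green function energy into the sum over all
  simplices \<open>z\<close> of \<open>omega z * S z ^ 2\<close>, where \<open>S z\<close> is the sum of \<open>omega\<close> over the faces of \<open>z\<close>.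
  This is the Euler characteristic of a full simplex, hence \<open>S z = 1\<close>.
\<close>

text \<open>Expanding the product of \<open>1 - 1\<close> over the elements of \<open>z\<close>
  gives one signed term per subset; the product vanishes since \<open>z\<close> is
  non-empty.\<close>

lemma sum_minus_one_power_card_Pow:
  assumes "finite z" "z \<noteq> {}"
  shows "(\<Sum>x\<in>Pow z. (-1) ^ card x) = (0 :: 'b::comm_ring_1)"
  using prod_diff_conv_sum[OF assms(1), of "\<lambda>_. 1 :: 'b" "\<lambda>_. 1"] assms
  by (simp add: power_0_left)

lemma sum_omega_faces:
  assumes "finite z" "z \<noteq> {}"
  shows "(\<Sum>x\<in>Pow z - {{}}. omega x) = 1"
proof -
  have "(\<Sum>x\<in>Pow z - {{}}. omega x) = (\<Sum>x\<in>Pow z - {{}}. - ((-1) ^ card x))"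
  proof (rule sum.cong[OF refl])
    fix x assume x: "x \<in> Pow z - {{}}"
    then have "finite x" using assms(1) finite_subset by auto
    \<comment> \<open>Non-emptiness makes \<open>card x - 1\<close> a genuine predecessor, so the
      exponent shift costs exactly one sign.\<close>
    with x obtain n where "card x = Suc n"
      by (metis DiffD2 card_0_eq not0_implies_Suc singletonI)
    then show "omega x = - ((-1) ^ card x)"
      by (simp add: omega_def simplex_dim_def)
  qed
  \<comment> \<open>The \<open>1\<close> compensates for adding back the empty set.\<close>
  also have "\<dots> = 1 - (\<Sum>x\<in>Pow z. (-1) ^ card x)"
    using assms(1) by (simp add: sum_negf sum_diff1)
  finally show ?thesis using sum_minus_one_power_card_Pow[OF assms, where ?'b = int] by simp
qed

theorem mainTheorem8:
  fixes G :: "'a set set"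
  assumes "finite_abstract_simplicial_complex G"
  shows "(\<Sum>x\<in>G. \<Sum>y\<in>G. green G x y) = euler_char G"
proof -
  have fin: "finite G" using assms unfolding finite_abstract_simplicial_complex_def by blast
  have faces: "(\<Sum>x\<in>G. if x \<subseteq> z then omega x else 0) = 1" if "z \<in> G" for z
  proof -
    \<comment> \<open>Closure under non-empty subsets puts every face of \<open>z\<close> in
      \<open>G\<close>.\<close>
    have z: "finite z" "z \<noteq> {}" and eq: "{x \<in> G. x \<subseteq> z} = Pow z - {{}}"
      using assms that unfolding finite_abstract_simplicial_complex_def by blast+
    have "(\<Sum>x\<in>G. if x \<subseteq> z then omega x else 0) = (\<Sum>x\<in>{x \<in> G. x \<subseteq> z}. omega x)"
      using fin by (simp add: sum.inter_filter)
    then show ?thesis using sum_omega_faces[OF z] eq by simp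
  qed
  \<comment> \<open>Indicators make the range of \<open>z\<close> independent of \<open>x\<close>
    and \<open>y\<close>, so the sums can be swapped, and split the condition on \<open>z\<close>
    into one factor for each of \<open>x\<close> and \<open>y\<close>.\<close>
  have green: "green G x y = (\<Sum>z\<in>G. omega z *
      ((if x \<subseteq> z then omega x else 0) * (if y \<subseteq> z then omega y else 0)))" for x y
  proof -
    have "star G x \<inter> star G y = {z \<in> G. x \<subseteq> z \<and> y \<subseteq> z}"
      by (auto simp: star_def)
    then have "green G x y = omega x * omega y * (\<Sum>z\<in>G. if x \<subseteq> z \<and> y \<subseteq> z then omega z else 0)"
      unfolding green_def euler_char_def using fin by (simp add: sum.inter_filter)
    also have "\<dots> = (\<Sum>z\<in>G. omega x * omega y * (if x \<subseteq> z \<and> y \<subseteq> z then omega z else 0))"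
      by (rule sum_distrib_left)
    finally show ?thesis
      by (auto intro!: sum.cong)
  qed
  have "(\<Sum>x\<in>G. \<Sum>y\<in>G. green G x y) = (\<Sum>x\<in>G. \<Sum>z\<in>G. \<Sum>y\<in>G. omega z *
      ((if x \<subseteq> z then omega x else 0) * (if y \<subseteq> z then omega y else 0)))"
    unfolding green by (intro sum.cong[OF refl] sum.swap)
  also have "\<dots> = (\<Sum>z\<in>G. \<Sum>x\<in>G. \<Sum>y\<in>G. omega z *
      ((if x \<subseteq> z then omega x else 0) * (if y \<subseteq> z then omega y else 0)))"
    by (rule sum.swap)
  \<comment> \<open>For fixed \<open>z\<close>, the double sum over \<open>x\<close> and
    \<open>y\<close> is a product of two equal sums.\<close>
  also have "\<dots> = (\<Sum>z\<in>G. omega z *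
      ((\<Sum>x\<in>G. if x \<subseteq> z then omega x else 0) * (\<Sum>y\<in>G. if y \<subseteq> z then omega y else 0)))"
    unfolding sum_product by (simp only: sum_distrib_left)
  also have "\<dots> = (\<Sum>z\<in>G. omega z)"
    by (simp add: faces)
  finally show ?thesis by (simp add: euler_char_def)
qed

end
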